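(* Let $p\in\Omega$ be the probability mass function of a random variable $Z$ taking values in $\mathbb{N}_0=\{0,1,2,\dots\}$, with $E[Z^2]<\infty$, let $I_d(p)$ be its discrete Fisher information, let $\mu = E[Z]$ be the mean and $\sigma^2 = E[Z^2]-E[Z]^2$ the variance of $Z$. Then $$\left(\sigma^2 + \frac{1}{2} - \frac{(\mu+1)^2}{2}\,p(0)\right) I_d(p)\;\geq\; \bigl(1-(\mu+1)p(0)\bigr)^2,$$ with equality if and only if $p(i)=\delta_{i0}$ for all $i\in\mathbb{N}_0$, where $\delta_{ij}$ denotes the Kronecker delta.
   Context: $\mathbb{N}_0=\{0,1,2,\dots\}$. $\Omega$ is the set of probability mass functions $p$ on $\mathbb{N}_0$ (so $p(i)\ge 0$ and $\sum_{i=0}^\infty p(i)=1$) which satisfy $\lim_{i\to\infty}p(i)=0$; a pmf with finite support in $\{0,\dots,N-1\}$ is extended by $p(i)=0$ for all $i\ge N$. The discrete Fisher information of $p\in\Omega$ is $$I_d(p)=4\sum_{i=0}^\infty\bigl(\sqrt{p(i+1)}-\sqrt{p(i)}\bigr)^2.$$ For a function $A$, $E[A(Z)]=\sum_{i=0}^\infty A(i)p(i)$. *)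

theory Defs
  imports "HOL-Probability.Probability"
begin

text \<open>Vanishing at infinity is automatic for a summable sequence; it is kept because it is part of the
  definition of the class \<open>\<Omega>\<close>.\<close>

definition Omega :: "nat pmf set" where
  "Omega = {p. (\<lambda>i. pmf p i) \<longlonglongrightarrow> 0}"

text \<open>The series always converges, its terms being bounded by \<open>pmf p (Suc i) + pmf p i\<close>.\<close>

definition discrete_fisher_information :: "nat pmf \<Rightarrow> real" where
  "discrete_fisher_information p = 4 * (\<Sum>i. (sqrt (pmf p (Suc i)) - sqrt (pmf p i))\<^sup>2)"

end

theory Submission
  imports Defs
begin

text \<open>
  Write \<open>q i\<close> for the masses, \<open>d i = sqrt (q (Suc i)) - sqrt (q i)\<close> and
  \<open>s i = sqrt (q (Suc i)) + sqrt (q i)\<close>, so that \<open>d i * s i = q (Suc i) - q i\<close>.  As in the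
  Cramer--Rao inequality, the increments of \<open>q\<close> are tested against the centred weight
  \<open>i - \<mu>\<close>: summation by parts gives \<open>(\<Sum>i. (i - \<mu>) * d i * s i) = (\<mu> + 1) * q 0 - 1\<close>, and
  the Cauchy--Schwarz inequality bounds its square by
  \<open>(\<Sum>i. (d i)\<^sup>2) * (\<Sum>i. ((i - \<mu>) * s i)\<^sup>2)\<close>.  The first factor is a quarter of the Fisher
  information.  For the second, \<open>(s i)\<^sup>2 + (d i)\<^sup>2 = 2 * q (Suc i) + 2 * q i\<close> shows that
  \<open>(\<Sum>i. ((i - \<mu>) * s i)\<^sup>2) + (\<Sum>i. ((i - \<mu>) * d i)\<^sup>2)
      = 4 * \<sigma>\<^sup>2 + 2 - 2 * (\<mu> + 1)\<^sup>2 * q 0\<close>,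
  which is four times the factor in the theorem (lemma \<open>weighted_square_sums\<close>).

  Discarding \<open>(\<Sum>i. ((i - \<mu>) * d i)\<^sup>2)\<close> proves the inequality.  As the Fisher information is
  positive, equality forces this discarded sum to vanish, so \<open>q\<close> can only jump from \<open>i\<close> to \<open>Suc i\<close>
  when \<open>i = \<mu>\<close>.  Then \<open>q\<close> vanishes to the right of its own mean, hence sits at the mean
  alone; and a point mass at \<open>m > 0\<close> would also jump between \<open>m - 1\<close> and \<open>m\<close>.  This is lemma
  \<open>point_mass_at_0_if_jumps_only_at_mean\<close>.
\<close>

section \<open>The Cauchy--Schwarz inequality for series\<close>

lemma Cauchy_Schwarz_suminf:
  fixes f g :: "nat \<Rightarrow> real"
  assumes fg: "summable (\<lambda>i. f i * g i)"
    and f: "summable (\<lambda>i. (f i)\<^sup>2)" and g: "summable (\<lambda>i. (g i)\<^sup>2)"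
  shows "(\<Sum>i. f i * g i)\<^sup>2 \<le> (\<Sum>i. (f i)\<^sup>2) * (\<Sum>i. (g i)\<^sup>2)"
proof (rule LIMSEQ_le)
  show "(\<lambda>n. (\<Sum>i<n. f i * g i)\<^sup>2) \<longlonglongrightarrow> (\<Sum>i. f i * g i)\<^sup>2"
    by (intro tendsto_power summable_LIMSEQ fg)
  show "(\<lambda>n. (\<Sum>i<n. (f i)\<^sup>2) * (\<Sum>i<n. (g i)\<^sup>2)) \<longlonglongrightarrow> (\<Sum>i. (f i)\<^sup>2) * (\<Sum>i. (g i)\<^sup>2)"
    by (intro tendsto_mult summable_LIMSEQ f g)
  show "\<exists>N. \<forall>n\<ge>N. (\<Sum>i<n. f i * g i)\<^sup>2 \<le> (\<Sum>i<n. (f i)\<^sup>2) * (\<Sum>i<n. (g i)\<^sup>2)"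
    using Cauchy_Schwarz_ineq_sum by blast
qed

section \<open>Mass sequences with two moments\<close>

text \<open>The inequality is a statement about the sequence of masses and its first two moments; a random
  variable enters only through them.\<close>

locale mass_sequence =
  fixes q :: "nat \<Rightarrow> real" and \<mu> m2 :: real
  assumes nonneg: "0 \<le> q i"
    and total_mass: "q sums 1"
    and first_moment: "(\<lambda>i. real i * q i) sums \<mu>"
    and second_moment: "(\<lambda>i. (real i)\<^sup>2 * q i) sums m2"
begin

definition root_diff :: "nat \<Rightarrow> real" where
  "root_diff i = sqrt (q (Suc i)) - sqrt (q i)"

definition root_sum :: "nat \<Rightarrow> real" where
  "root_sum i = sqrt (q (Suc i)) + sqrt (q i)"

lemma root_diff_times_root_sum: "root_diff i * root_sum i = q (Suc i) - q i"
  using nonneg by (simp add: root_diff_def root_sum_def algebra_simps)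

lemma root_squares: "(root_sum i)\<^sup>2 + (root_diff i)\<^sup>2 = 2 * q (Suc i) + 2 * q i"
  using nonneg by (simp add: root_diff_def root_sum_def power2_eq_square algebra_simps)

lemma root_diff_eq_0_iff: "root_diff i = 0 \<longleftrightarrow> q (Suc i) = q i"
  by (simp add: root_diff_def)

lemma tendsto_0: "q \<longlonglongrightarrow> 0"
  using total_mass summable_LIMSEQ_zero sums_summable by blast

lemma quadratic_moment:
  "(\<lambda>i. (a * (real i)\<^sup>2 + b * real i + c) * q i) sums (a * m2 + b * \<mu> + c)"
proof -
  have "(\<lambda>i. a * ((real i)\<^sup>2 * q i) + b * (real i * q i) + c * q i) sums (a * m2 + b * \<mu> + c * 1)"
    by (intro sums_add sums_mult first_moment second_moment total_mass)
  then show ?thesis by (simp add: algebra_simps)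
qed

text \<open>The shift loses the term at index \<open>0\<close>, which is the source of every \<open>q 0\<close> in the inequality.\<close>

lemma quadratic_moment_Suc:
  "(\<lambda>i. (a * (real (Suc i))\<^sup>2 + b * real (Suc i) + c) * q (Suc i))
     sums (a * m2 + b * \<mu> + c - c * q 0)"
  by (subst sums_Suc_iff) (use quadratic_moment[of a b c] in simp)

lemma summable_root_diff_squares: "summable (\<lambda>i. (root_diff i)\<^sup>2)"
proof (rule summable_comparison_test')
  show "summable (\<lambda>i. 2 * q (Suc i) + 2 * q i)"
    using total_mass by (intro summable_add summable_mult) (simp_all add: summable_Suc_iff sums_iff)
  show "norm ((root_diff i)\<^sup>2) \<le> 2 * q (Suc i) + 2 * q i" for i
    using root_squares[of i] zero_le_power2[of "root_sum i"] zero_le_power2[of "root_diff i"]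
    unfolding real_norm_def by linarith
qed

lemma not_constant: "\<exists>i. q (Suc i) \<noteq> q i"
proof (rule ccontr)
  assume "\<not> ?thesis"
  then have "q i = q 0" for i by (induction i) auto
  then have "q = (\<lambda>_. q 0)" by blast
  then have "q 0 = 0" using tendsto_0 by (metis LIMSEQ_const_iff)
  with \<open>q = (\<lambda>_. q 0)\<close> have "q = (\<lambda>_. 0)" by metis
  then show False using total_mass sums_zero sums_unique2 by fastforce
qed

lemma root_diff_squares_pos: "0 < (\<Sum>i. (root_diff i)\<^sup>2)"
  using not_constant summable_root_diff_squares
  by (auto intro!: suminf_pos2 simp: root_diff_eq_0_iff)

text \<open>Summation by parts, carried out as a shift of the index: moving \<open>q (Suc i)\<close> back to \<open>q i\<close>
  lowers its weight by one and loses the term at \<open>0\<close>.\<close>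

lemma centred_increments:
  "(\<lambda>i. root_diff i * ((real i - \<mu>) * root_sum i)) sums ((\<mu> + 1) * q 0 - 1)"
proof -
  have eq: "root_diff i * ((real i - \<mu>) * root_sum i) =
      (0 * (real (Suc i))\<^sup>2 + 1 * real (Suc i) + (- 1 - \<mu>)) * q (Suc i) -
      (0 * (real i)\<^sup>2 + 1 * real i + (- \<mu>)) * q i" for i
  proof -
    have "root_diff i * ((real i - \<mu>) * root_sum i)
        = (real i - \<mu>) * (root_diff i * root_sum i)"
      by (simp add: mult_ac)
    then show ?thesis
      unfolding root_diff_times_root_sum by (simp add: algebra_simps)
  qed
  have "(\<lambda>i. root_diff i * ((real i - \<mu>) * root_sum i)) sums
     ((0 * m2 + 1 * \<mu> + (- 1 - \<mu>) - (- 1 - \<mu>) * q 0) - (0 * m2 + 1 * \<mu> + (- \<mu>)))"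
    unfolding eq by (intro sums_diff quadratic_moment_Suc quadratic_moment)
  then show ?thesis by (simp add: algebra_simps)
qed

lemma centred_squares:
  "(\<lambda>i. ((real i - \<mu>) * root_sum i)\<^sup>2 + ((real i - \<mu>) * root_diff i)\<^sup>2)
     sums (4 * ((m2 - \<mu>\<^sup>2) + 1 / 2 - (\<mu> + 1)\<^sup>2 / 2 * q 0))"
proof -
  have eq: "((real i - \<mu>) * root_sum i)\<^sup>2 + ((real i - \<mu>) * root_diff i)\<^sup>2 =
      (2 * (real (Suc i))\<^sup>2 + (- 4 * (\<mu> + 1)) * real (Suc i) + 2 * (\<mu> + 1)\<^sup>2) * q (Suc i) +
      (2 * (real i)\<^sup>2 + (- 4 * \<mu>) * real i + 2 * \<mu>\<^sup>2) * q i" for i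
  proof -
    have "((real i - \<mu>) * root_sum i)\<^sup>2 + ((real i - \<mu>) * root_diff i)\<^sup>2
        = (real i - \<mu>)\<^sup>2 * ((root_sum i)\<^sup>2 + (root_diff i)\<^sup>2)"
      by (simp add: power_mult_distrib distrib_left)
    then show ?thesis
      unfolding root_squares by (simp add: power2_eq_square algebra_simps)
  qed
  have "(\<lambda>i. ((real i - \<mu>) * root_sum i)\<^sup>2 + ((real i - \<mu>) * root_diff i)\<^sup>2) sums
     ((2 * m2 + (- 4 * (\<mu> + 1)) * \<mu> + 2 * (\<mu> + 1)\<^sup>2 - 2 * (\<mu> + 1)\<^sup>2 * q 0)
      + (2 * m2 + (- 4 * \<mu>) * \<mu> + 2 * \<mu>\<^sup>2))"
    unfolding eq by (intro sums_add quadratic_moment_Suc quadratic_moment)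
  moreover have "(2 * m2 + (- 4 * (\<mu> + 1)) * \<mu> + 2 * (\<mu> + 1)\<^sup>2 - 2 * (\<mu> + 1)\<^sup>2 * q 0)
      + (2 * m2 + (- 4 * \<mu>) * \<mu> + 2 * \<mu>\<^sup>2)
      = 4 * ((m2 - \<mu>\<^sup>2) + 1 / 2 - (\<mu> + 1)\<^sup>2 / 2 * q 0)"
    by (simp add: power2_eq_square field_simps)
  ultimately show ?thesis by (simp only:)
qed

lemma summable_centred_root_sum: "summable (\<lambda>i. ((real i - \<mu>) * root_sum i)\<^sup>2)"
  by (rule summable_comparison_test'[OF sums_summable[OF centred_squares]]) simp

lemma summable_centred_root_diff: "summable (\<lambda>i. ((real i - \<mu>) * root_diff i)\<^sup>2)"
  by (rule summable_comparison_test'[OF sums_summable[OF centred_squares]]) simp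

lemma weighted_square_sums:
  "(\<Sum>i. ((real i - \<mu>) * root_sum i)\<^sup>2) + (\<Sum>i. ((real i - \<mu>) * root_diff i)\<^sup>2)
     = 4 * ((m2 - \<mu>\<^sup>2) + 1 / 2 - (\<mu> + 1)\<^sup>2 / 2 * q 0)"
  using suminf_add[OF summable_centred_root_sum summable_centred_root_diff]
    sums_unique[OF centred_squares] by simp

section \<open>The inequality and its defect\<close>

text \<open>The second summand on the left is what the plain inequality discards; it has to vanish in the
  case of equality.\<close>

lemma inequality_with_defect:
  "(1 - (\<mu> + 1) * q 0)\<^sup>2
     + (\<Sum>i. (root_diff i)\<^sup>2) * (\<Sum>i. ((real i - \<mu>) * root_diff i)\<^sup>2)
   \<le> ((m2 - \<mu>\<^sup>2) + 1 / 2 - (\<mu> + 1)\<^sup>2 / 2 * q 0) * (4 * (\<Sum>i. (root_diff i)\<^sup>2))"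
proof -
  let ?D = "\<Sum>i. (root_diff i)\<^sup>2"
  let ?S = "\<Sum>i. ((real i - \<mu>) * root_sum i)\<^sup>2"
  let ?E = "\<Sum>i. ((real i - \<mu>) * root_diff i)\<^sup>2"
  have "(1 - (\<mu> + 1) * q 0)\<^sup>2 = ((\<mu> + 1) * q 0 - 1)\<^sup>2"
    by (rule power2_commute)
  also have "\<dots> = (\<Sum>i. root_diff i * ((real i - \<mu>) * root_sum i))\<^sup>2"
    using sums_unique[OF centred_increments] by simp
  also have "\<dots> \<le> ?D * ?S"
    by (intro Cauchy_Schwarz_suminf sums_summable[OF centred_increments]
        summable_root_diff_squares summable_centred_root_sum)
  finally have "(1 - (\<mu> + 1) * q 0)\<^sup>2 + ?D * ?E \<le> ?D * (?S + ?E)"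
    by (simp add: distrib_left)
  then show ?thesis
    unfolding weighted_square_sums by (simp only: mult_ac)
qed

text \<open>Beyond the mean the sequence is constant and tends to \<open>0\<close>, so it vanishes there; having no
  mass above its mean, it has none below it either, and so is a point mass at \<open>m = \<mu>\<close>.  If \<open>m\<close>
  were positive, the sequence would jump from \<open>0\<close> to \<open>1\<close> between \<open>m - 1 \<noteq> \<mu>\<close> and \<open>m\<close>, which is
  excluded.\<close>

lemma point_mass_at_0_if_jumps_only_at_mean:
  assumes jumps: "\<And>i. real i \<noteq> \<mu> \<Longrightarrow> q (Suc i) = q i"
  shows "q i = (if i = 0 then 1 else 0)"
proof -
  have above: "q i = 0" if "\<mu> < real i" for i
  proof -
    have "q (k + i) = q i" for k
    proof (induction k)
      case (Suc k)
      have "real (k + i) \<noteq> \<mu>" using that by simp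
      then show ?case using jumps[of "k + i"] Suc by simp
    qed simp
    then have "(\<lambda>_. q i) \<longlonglongrightarrow> 0"
      using LIMSEQ_ignore_initial_segment[OF tendsto_0, of i] by simp
    then show ?thesis by (simp add: LIMSEQ_const_iff)
  qed
  have away: "q i = 0" if "real i \<noteq> \<mu>" for i
  proof -
    have sums: "(\<lambda>i. (\<mu> - real i) * q i) sums 0"
      using quadratic_moment[of 0 "- 1" \<mu>] by (simp add: algebra_simps)
    have "0 \<le> (\<mu> - real i) * q i" for i
      using above[of i] nonneg[of i] by (cases "\<mu> < real i") auto
    then have "\<forall>i. (\<mu> - real i) * q i = 0"
      using suminf_eq_zero_iff[OF sums_summable[OF sums]] sums_unique[OF sums] by auto
    then show ?thesis using that by auto
  qed
  have "\<exists>m. real m = \<mu>"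
  proof (rule ccontr)
    assume "\<not> ?thesis"
    then have "q = (\<lambda>_. 0)" using away by blast
    then show False using not_constant by simp
  qed
  then obtain m where m: "real m = \<mu>" ..
  have off: "q i = 0" if "i \<noteq> m" for i
    using away that m by auto
  have "q sums q m"
    using sums_finite[of "{m}" q] off by simp
  then have "q m = 1" using total_mass sums_unique2 by blast
  moreover have "m = 0"
  proof (cases m)
    case (Suc k)
    then have "q m = q k" using jumps[of k] m by auto
    with Suc off[of k] \<open>q m = 1\<close> show ?thesis by simp
  qed
  ultimately show ?thesis using off by auto
qed

lemma point_mass_at_0_if_defect_0:
  assumes "(\<Sum>i. ((real i - \<mu>) * root_diff i)\<^sup>2) = 0"
  shows "q i = (if i = 0 then 1 else 0)"
proof (rule point_mass_at_0_if_jumps_only_at_mean)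
  have "\<forall>i. ((real i - \<mu>) * root_diff i)\<^sup>2 = 0"
    using assms suminf_eq_zero_iff[OF summable_centred_root_diff] by simp
  then show "q (Suc i) = q i" if "real i \<noteq> \<mu>" for i
    using that by (auto simp: root_diff_eq_0_iff)
qed

lemma moments_of_point_mass_at_0:
  assumes "\<And>i. q i = (if i = 0 then 1 else 0)"
  shows "\<mu> = 0" "m2 = 0"
proof -
  have "(\<lambda>i. real i * q i) = (\<lambda>_. 0)" "(\<lambda>i. (real i)\<^sup>2 * q i) = (\<lambda>_. 0)"
    by (auto simp: assms)
  then show "\<mu> = 0" "m2 = 0"
    using first_moment second_moment sums_zero sums_unique2 by metis+
qed

theorem fisher_inequality:
  fixes I V :: real
  defines "I \<equiv> 4 * (\<Sum>i. (root_diff i)\<^sup>2)"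
    and "V \<equiv> (m2 - \<mu>\<^sup>2) + 1 / 2 - (\<mu> + 1)\<^sup>2 / 2 * q 0"
  shows "(1 - (\<mu> + 1) * q 0)\<^sup>2 \<le> V * I"
    and "V * I = (1 - (\<mu> + 1) * q 0)\<^sup>2 \<longleftrightarrow> (\<forall>i. q i = (if i = 0 then 1 else 0))"
proof -
  let ?D = "\<Sum>i. (root_diff i)\<^sup>2"
  let ?E = "\<Sum>i. ((real i - \<mu>) * root_diff i)\<^sup>2"
  have E: "0 \<le> ?E" by (intro suminf_nonneg summable_centred_root_diff) simp
  have D: "0 < ?D" by (rule root_diff_squares_pos)
  have defect: "(1 - (\<mu> + 1) * q 0)\<^sup>2 + ?D * ?E \<le> V * I"
    unfolding I_def V_def by (rule inequality_with_defect)
  have "0 \<le> ?D * ?E" using D E by simp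
  with defect show "(1 - (\<mu> + 1) * q 0)\<^sup>2 \<le> V * I" by linarith
  show "V * I = (1 - (\<mu> + 1) * q 0)\<^sup>2 \<longleftrightarrow> (\<forall>i. q i = (if i = 0 then 1 else 0))"
  proof
    assume "V * I = (1 - (\<mu> + 1) * q 0)\<^sup>2"
    with defect have "?D * ?E \<le> 0" by linarith
    with D E have "?E = 0" by (simp add: mult_le_0_iff)
    then show "\<forall>i. q i = (if i = 0 then 1 else 0)"
      using point_mass_at_0_if_defect_0 by blast
  next
    assume "\<forall>i. q i = (if i = 0 then 1 else 0)"
    then show "V * I = (1 - (\<mu> + 1) * q 0)\<^sup>2"
      using moments_of_point_mass_at_0 by (simp add: V_def)
  qed
qed

end

section \<open>Expectations as series\<close>

lemma expectation_sums:
  fixes g :: "nat \<Rightarrow> real"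
  assumes Z: "Z \<in> measurable M (count_space UNIV)"
    and law: "distr M (count_space UNIV) Z = measure_pmf p"
    and int: "integrable M (\<lambda>\<omega>. g (Z \<omega>))"
  shows "(\<lambda>i. g i * pmf p i) sums (\<integral>\<omega>. g (Z \<omega>) \<partial>M)"
proof -
  have "integrable (distr M (count_space UNIV) Z) g"
    using Z int by (simp add: integrable_distr_eq)
  then have "integrable (density (count_space UNIV) (\<lambda>i. ennreal (pmf p i))) g"
    by (simp add: law measure_pmf_eq_density)
  then have "integrable (count_space UNIV) (\<lambda>i. g i * pmf p i)"
    by (subst (asm) integrable_density) (auto simp: mult.commute)
  then have "(\<lambda>i. g i * pmf p i) sums (\<integral>i. g i * pmf p i \<partial>count_space UNIV)"
    by (rule sums_integral_count_space_nat)
  also have "(\<integral>i. g i * pmf p i \<partial>count_space UNIV)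
      = integral\<^sup>L (density (count_space UNIV) (\<lambda>i. ennreal (pmf p i))) g"
    by (subst integral_density) (auto simp: mult.commute)
  also have "\<dots> = integral\<^sup>L (distr M (count_space UNIV) Z) g"
    by (simp add: law measure_pmf_eq_density)
  also have "\<dots> = (\<integral>\<omega>. g (Z \<omega>) \<partial>M)"
    using Z by (simp add: integral_distr)
  finally show ?thesis .
qed

theorem theorem1:
  fixes M :: "'a measure" and Z :: "'a \<Rightarrow> nat" and p :: "nat pmf" and \<mu> \<sigma>2 :: real
  assumes "prob_space M"
    and "Z \<in> measurable M (count_space UNIV)"
    and "distr M (count_space UNIV) Z = measure_pmf p"
    and "p \<in> Omega"
    and "integrable M (\<lambda>\<omega>. (real (Z \<omega>))\<^sup>2)"
    and "\<mu> = prob_space.expectation M (\<lambda>\<omega>. real (Z \<omega>))"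
    and "\<sigma>2 = prob_space.expectation M (\<lambda>\<omega>. (real (Z \<omega>))\<^sup>2)
              - (prob_space.expectation M (\<lambda>\<omega>. real (Z \<omega>)))\<^sup>2"
  shows "(\<sigma>2 + 1 / 2 - (\<mu> + 1)\<^sup>2 / 2 * pmf p 0) * discrete_fisher_information p
           \<ge> (1 - (\<mu> + 1) * pmf p 0)\<^sup>2
       \<and> ((\<sigma>2 + 1 / 2 - (\<mu> + 1)\<^sup>2 / 2 * pmf p 0) * discrete_fisher_information p
           = (1 - (\<mu> + 1) * pmf p 0)\<^sup>2
          \<longleftrightarrow> (\<forall>i. pmf p i = (if i = 0 then 1 else 0)))"
proof -
  interpret prob_space M by fact
  note Z[measurable] = assms(2)
  have int1: "integrable M (\<lambda>\<omega>. real (Z \<omega>))"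
  proof (rule Bochner_Integration.integrable_bound[OF assms(5)])
    show "AE \<omega> in M. norm (real (Z \<omega>)) \<le> norm ((real (Z \<omega>))\<^sup>2)"
      by (simp add: power2_nat_le_imp_le power2_eq_square flip: of_nat_mult)
  qed measurable
  have int0: "integrable M (\<lambda>\<omega>. 1 :: real)" by simp
  have "(\<lambda>i. 1 * pmf p i) sums (\<integral>\<omega>. 1 \<partial>M)"
    by (rule expectation_sums[OF assms(2,3) int0])
  moreover have "(\<lambda>i. real i * pmf p i) sums \<mu>"
    unfolding assms(6) by (rule expectation_sums[OF assms(2,3) int1])
  moreover have "(\<lambda>i. (real i)\<^sup>2 * pmf p i) sums expectation (\<lambda>\<omega>. (real (Z \<omega>))\<^sup>2)"
    by (rule expectation_sums[OF assms(2,3,5)])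
  ultimately interpret mass_sequence "pmf p" \<mu> "expectation (\<lambda>\<omega>. (real (Z \<omega>))\<^sup>2)"
    by unfold_locales (simp_all add: prob_space)
  have \<sigma>2: "\<sigma>2 = expectation (\<lambda>\<omega>. (real (Z \<omega>))\<^sup>2) - \<mu>\<^sup>2"
    using assms(6,7) by simp
  have I: "discrete_fisher_information p = 4 * (\<Sum>i. (root_diff i)\<^sup>2)"
    by (simp add: discrete_fisher_information_def root_diff_def)
  show ?thesis
    unfolding \<sigma>2 I using fisher_inequality by blast
qed

end
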